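(* Every Frenet curve has a family of successor curves. More precisely, let $\mathcal F=(\mathbf T,\mathbf N,\mathbf B,\kappa,\tau)$ be a Frenet apparatus, on an interval $I$ with arc-length parameter $s$, of a unit speed Frenet curve in $\mathbb R^3$. Then the totality of successor systems of $\mathcal F$, that is, of Frenet apparatuses $\mathcal F_*=(\mathbf T_*,\mathbf N_*,\mathbf B_*,\kappa_*,\tau_* )$ with $\mathbf N_*\equiv\mathbf T$, is given by \[ \begin{pmatrix}\mathbf T_*\\ \mathbf N_*\\ \mathbf B_*\end{pmatrix}= \begin{pmatrix}0&-\cos\varphi&\sin\varphi\\ 1&0&0\\ 0&\sin\varphi&\cos\varphi\end{pmatrix} \begin{pmatrix}\mathbf T\\ \mathbf N\\ \mathbf B\end{pmatrix},\qquad \begin{pmatrix}\kappa_*\\ \tau_*\end{pmatrix}=\kappa\begin{pmatrix}\cos\varphi\\ \sin\varphi\end{pmatrix},\qquad \varphi(s)=\varphi_0+\int\tau(s)\,ds, \] depending on a parameter $\varphi_0\in\mathbb R$ (where $\int\tau(s)\,ds$ denotes a fixed antiderivative of $\tau$ on $I$). The Darboux vector of $\mathcal F_*$ is $\mathbf D_*=\kappa\mathbf B$.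
   Context: Curves are regular $C^2$ curves in oriented Euclidean $\mathbb R^3$ on an interval, parametrized by arc length $s$; a prime denotes $d/ds$; $\mathbf T=\mathbf x'$ is the unit tangent of $\mathbf x$. A Frenet apparatus (Frenet system) is a tuple $(\mathbf T,\mathbf N,\mathbf B,\kappa,\tau)$ in which $(\mathbf T,\mathbf N,\mathbf B)$ is a $C^1$ positively oriented orthonormal frame along the curve, $\mathbf T$ is the unit tangent, $\kappa,\tau$ are continuous real functions, and $\mathbf T'=\kappa\mathbf N$, $\mathbf N'=-\kappa\mathbf T+\tau\mathbf B$, $\mathbf B'=-\tau\mathbf N$. The curvature $\kappa$ is signed and may vanish, even on intervals, so the Frenet frame $(\mathbf T,\mathbf N,\mathbf B)$ of a curve need not be unique. $\mathbf N$ is called a principal normal. A Frenet curve is a curve that possesses a Frenet frame. The Darboux vector of a Frenet apparatus is $\mathbf D=\tau\mathbf T+\kappa\mathbf B$. A successor curve of a unit speed curve $\mathbf x(s)$ with unit tangent $\mathbf T(s)$ is a unit speed curve $\mathbf x_*(s)$ (same parameter) that has $\mathbf T$ as principal normal. A Frenet frame $(\mathbf T_*,\mathbf N_*,\mathbf B_* )$ is a successor frame of the Frenet frame $(\mathbf T,\mathbf N,\mathbf B)$ if $\mathbf N_*\equiv\mathbf T$. *)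

theory Defs
  imports "HOL-Analysis.Analysis"
begin

text \<open>
  All derivatives are taken within the parameter interval, so they are one-sided at
  endpoints belonging to it.  (The library's predicate for continuous differentiability on a
  set uses two-sided derivatives and would constrain functions outside the interval.)
\<close>

definition C1_on :: "real set \<Rightarrow> (real \<Rightarrow> 'a::real_normed_vector) \<Rightarrow> bool" where
  "C1_on I f \<longleftrightarrow>
     (\<exists>f'. (\<forall>s\<in>I. (f has_vector_derivative f' s) (at s within I)) \<and> continuous_on I f')"

definition tangent_on :: "real set \<Rightarrow> (real \<Rightarrow> real^3) \<Rightarrow> (real \<Rightarrow> real^3) \<Rightarrow> bool" where
  "tangent_on I x T \<longleftrightarrow> (\<forall>s\<in>I. (x has_vector_derivative T s) (at s within I))"

text \<open>A \<open>C\<^sup>2\<close> curve parametrized by arc length; regularity is implied by unit speed.\<close>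

definition unit_speed_curve :: "real set \<Rightarrow> (real \<Rightarrow> real^3) \<Rightarrow> bool" where
  "unit_speed_curve I x \<longleftrightarrow>
     (\<exists>T. tangent_on I x T \<and> C1_on I T \<and> (\<forall>s\<in>I. norm (T s) = 1))"

definition orthonormal_positive :: "real^3 \<Rightarrow> real^3 \<Rightarrow> real^3 \<Rightarrow> bool" where
  "orthonormal_positive u v w \<longleftrightarrow>
     norm u = 1 \<and> norm v = 1 \<and> norm w = 1 \<and>
     orthogonal u v \<and> orthogonal u w \<and> orthogonal v w \<and>
     det (vector [u, v, w] :: real^3^3) > 0"

definition frenet_apparatus ::
  "real set \<Rightarrow> (real \<Rightarrow> real^3) \<Rightarrow>
   (real \<Rightarrow> real^3) \<Rightarrow> (real \<Rightarrow> real^3) \<Rightarrow> (real \<Rightarrow> real^3) \<Rightarrow> (real \<Rightarrow> real) \<Rightarrow> (real \<Rightarrow> real) \<Rightarrow> bool"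
where
  "frenet_apparatus I x T N B \<kappa> \<tau> \<longleftrightarrow>
     unit_speed_curve I x \<and> tangent_on I x T \<and>
     C1_on I T \<and> C1_on I N \<and> C1_on I B \<and>
     (\<forall>s\<in>I. orthonormal_positive (T s) (N s) (B s)) \<and>
     continuous_on I \<kappa> \<and> continuous_on I \<tau> \<and>
     (\<forall>s\<in>I. (T has_vector_derivative \<kappa> s *\<^sub>R N s) (at s within I) \<and>
            (N has_vector_derivative - \<kappa> s *\<^sub>R T s + \<tau> s *\<^sub>R B s) (at s within I) \<and>
            (B has_vector_derivative - \<tau> s *\<^sub>R N s) (at s within I))"

definition darboux ::
  "(real \<Rightarrow> real^3) \<Rightarrow> (real \<Rightarrow> real^3) \<Rightarrow> (real \<Rightarrow> real) \<Rightarrow> (real \<Rightarrow> real) \<Rightarrow> real \<Rightarrow> real^3"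
where
  "darboux T B \<kappa> \<tau> s = \<tau> s *\<^sub>R T s + \<kappa> s *\<^sub>R B s"

text \<open>Principal normals need not be unique, since the curvature may vanish.\<close>

definition principal_normal :: "real set \<Rightarrow> (real \<Rightarrow> real^3) \<Rightarrow> (real \<Rightarrow> real^3) \<Rightarrow> bool" where
  "principal_normal I x N \<longleftrightarrow> (\<exists>T B \<kappa> \<tau>. frenet_apparatus I x T N B \<kappa> \<tau>)"

definition successor_curve :: "real set \<Rightarrow> (real \<Rightarrow> real^3) \<Rightarrow> (real \<Rightarrow> real^3) \<Rightarrow> bool" where
  "successor_curve I x xs \<longleftrightarrow>
     unit_speed_curve I x \<and> unit_speed_curve I xs \<and>
     (\<exists>T. tangent_on I x T \<and> principal_normal I xs T)"

text \<open>
  A successor system of a Frenet apparatus depends on that apparatus only through its unit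
  tangent \<open>T\<close>.  It is a Frenet apparatus of some unit speed curve \<open>xs\<close> with the same parameter.
\<close>

definition successor_system ::
  "real set \<Rightarrow> (real \<Rightarrow> real^3) \<Rightarrow>
   (real \<Rightarrow> real^3) \<Rightarrow> (real \<Rightarrow> real^3) \<Rightarrow> (real \<Rightarrow> real^3) \<Rightarrow> (real \<Rightarrow> real) \<Rightarrow> (real \<Rightarrow> real) \<Rightarrow> bool"
where
  "successor_system I T Ts Ns Bs \<kappa>s \<tau>s \<longleftrightarrow>
     (\<exists>xs. frenet_apparatus I xs Ts Ns Bs \<kappa>s \<tau>s) \<and> (\<forall>s\<in>I. Ns s = T s)"

definition antiderivative_on :: "real set \<Rightarrow> (real \<Rightarrow> real) \<Rightarrow> (real \<Rightarrow> real) \<Rightarrow> bool" where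
  "antiderivative_on I f F \<longleftrightarrow> (\<forall>s\<in>I. (F has_real_derivative f s) (at s within I))"

end

theory Submission
  imports Defs
begin

text \<open>
  A positive orthonormal frame \<open>(Ts, T, Bs)\<close> is a Frenet frame iff \<open>Ts'\<close>
  is parallel to \<open>T\<close>, i.e. when the unit field \<open>Ts\<close> is parallel in the normal bundle of the
  given curve.  Its coordinates \<open>p\<close>, \<open>q\<close> with respect to \<open>N\<close>, \<open>B\<close> satisfy \<open>p' = \<tau> q\<close>,
  \<open>q' = - \<tau> p\<close>, hence \<open>(p, q)\<close> rotates with angular speed \<open>\<tau>\<close> and becomes constant after
  a rotation by an antiderivative of \<open>\<tau>\<close>; that constant is the parameter \<open>\<phi>0\<close>.  The curvature
  and the torsion are read off by comparing \<open>T' = \<kappa> N\<close> with \<open>T' = - \<kappa>s Ts + \<tau>s Bs\<close>.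
\<close>

section \<open>Positive orthonormal triples via the cross product\<close>

unbundle cross3_syntax

text \<open>Turns orientation into an equation. As \<open>w\<close> is orthogonal to
  \<open>u\<close> and \<open>v\<close>, its cross product with \<open>u \<times> v\<close>
  vanishes, so these two unit vectors are parallel with inner product 1 or -1. The sign of the
  determinant selects 1, and then the difference has length zero.\<close>

lemma orthonormal_positive_iff_cross:
  "orthonormal_positive u v w \<longleftrightarrow> u \<bullet> u = 1 \<and> v \<bullet> v = 1 \<and> u \<bullet> v = 0 \<and> w = u \<times> v"
proof
  assume "orthonormal_positive u v w"
  then have unit: "u \<bullet> u = 1" "v \<bullet> v = 1" "w \<bullet> w = 1"
    and orth: "u \<bullet> v = 0" "u \<bullet> w = 0" "v \<bullet> w = 0"
    and pos: "(u \<times> v) \<bullet> w > 0"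
    unfolding orthonormal_positive_def
    by (simp_all add: norm_eq_1 orthogonal_def flip: dot_cross_det)
       (metis cross_triple inner_commute)
  have cross_unit: "(u \<times> v) \<bullet> (u \<times> v) = 1"
    using norm_cross[of u v] unit orth by (simp add: power2_norm_eq_inner)
  have "w \<times> (u \<times> v) = 0"
    using orth by (simp add: Lagrange inner_commute)
  then have "((u \<times> v) \<bullet> w)\<^sup>2 = 1"
    using norm_cross[of w "u \<times> v"] unit cross_unit
    by (simp add: power2_norm_eq_inner inner_commute)
  with pos have "(u \<times> v) \<bullet> w = 1"
    by (simp add: power2_eq_1_iff)
  then have "(w - u \<times> v) \<bullet> (w - u \<times> v) = 0"
    using unit cross_unit by (simp add: inner_diff inner_commute)
  then show "u \<bullet> u = 1 \<and> v \<bullet> v = 1 \<and> u \<bullet> v = 0 \<and> w = u \<times> v"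
    using unit orth by simp
next
  assume asm: "u \<bullet> u = 1 \<and> v \<bullet> v = 1 \<and> u \<bullet> v = 0 \<and> w = u \<times> v"
  then have "w \<bullet> w = 1"
    using norm_cross[of u v] by (simp add: power2_norm_eq_inner)
  moreover from this have "det (vector [u, v, w] :: real^3^3) = 1"
    using asm by (metis cross_triple dot_cross_det inner_commute)
  ultimately show "orthonormal_positive u v w"
    using asm by (simp add: orthonormal_positive_def norm_eq_1 orthogonal_def dot_cross_self)
qed

lemma orthonormal_positiveD:
  assumes "orthonormal_positive u v w"
  shows "u \<bullet> u = 1" "v \<bullet> v = 1" "w \<bullet> w = 1"
    and "u \<bullet> v = 0" "v \<bullet> u = 0" "u \<bullet> w = 0" "w \<bullet> u = 0" "v \<bullet> w = 0" "w \<bullet> v = 0"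
  using assms by (simp_all add: orthonormal_positive_def norm_eq_1 orthogonal_def inner_commute)

lemma orthonormal_positive_cross:
  assumes "orthonormal_positive u v w"
  shows "u \<times> v = w" "v \<times> w = u" "w \<times> u = v"
proof -
  have w: "w = u \<times> v"
    using assms by (simp add: orthonormal_positive_iff_cross)
  then show "u \<times> v = w" by simp
  show "v \<times> w = u"
    using orthonormal_positiveD[OF assms] by (simp add: w Lagrange)
  have "u \<times> w = - v"
    using orthonormal_positiveD[OF assms] by (simp add: w Lagrange)
  then show "w \<times> u = v"
    using cross_skew[of w u] by simp
qed

text \<open>On the plane orthogonal to the unit vector \<open>u\<close>, the map taking
  \<open>y\<close> to \<open>u \<times> (y \<times> u)\<close> is the identity. Writing the inner
  \<open>u\<close> as \<open>v \<times> w\<close> and expanding by Lagrange's identity produces the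
  coordinates.\<close>

lemma orthonormal_positive_expand:
  assumes "orthonormal_positive u v w" and "y \<bullet> u = 0"
  shows "y = (y \<bullet> v) *\<^sub>R v + (y \<bullet> w) *\<^sub>R w"
proof -
  note cross = orthonormal_positive_cross[OF assms(1)]
  have "y = u \<times> (y \<times> u)"
    using assms(2) orthonormal_positiveD[OF assms(1)] by (simp add: Lagrange inner_commute)
  also have "y \<times> u = (y \<bullet> w) *\<^sub>R v - (y \<bullet> v) *\<^sub>R w"
    using Lagrange[of y v w] cross by simp
  also have "u \<times> \<dots> = (y \<bullet> v) *\<^sub>R v + (y \<bullet> w) *\<^sub>R w"
    using cross cross_skew[of u w]
    by (simp add: Cross3.right_diff_distrib cross_mult_right)
  finally show ?thesis .
qed

lemma orthonormal_positive_rotate: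
  assumes "orthonormal_positive t n b"
  shows "orthonormal_positive (- cos a *\<^sub>R n + sin a *\<^sub>R b) t (sin a *\<^sub>R n + cos a *\<^sub>R b)"
proof -
  note cross = orthonormal_positive_cross[OF assms]
  have "n \<times> t = - b"
    using cross cross_skew[of n t] by simp
  then show ?thesis
    unfolding orthonormal_positive_iff_cross
    using orthonormal_positiveD[OF assms] cross
    by (simp add: inner_simps cross_add_left cross_mult_left Cross3.left_diff_distrib
             flip: power2_eq_square)
qed

section \<open>Antiderivatives on arbitrary intervals\<close>

text \<open>Serves both for the angle (an antiderivative of \<tau>) and for recovering a curve from
  its tangent. \<open>I\<close> may be open, half-open or unbounded, so the integral from a base
  point \<open>c\<close> is differentiated at \<open>s\<close> inside a compact subinterval that is
  a neighbourhood of \<open>s\<close> relative to \<open>I\<close>.\<close>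

lemma interval_antiderivative:
  fixes f :: "real \<Rightarrow> 'a::euclidean_space"
  assumes I: "is_interval I" and f: "continuous_on I f"
  shows "\<exists>F. \<forall>s\<in>I. (F has_vector_derivative f s) (at s within I)"
proof (cases "I = {}")
  case False
  then obtain c where c: "c \<in> I" by blast
  have "((\<lambda>u. LBINT y=c..u. f y) has_vector_derivative f s) (at s within I)" if s: "s \<in> I" for s
  proof -
    \<comment> \<open>\<open>a\<close> lies strictly to the left of \<open>s\<close> unless
      \<open>s\<close> is the left endpoint of \<open>I\<close>; \<open>b\<close> is chosen
      symmetrically.\<close>
    obtain a where a: "a \<in> I" "a \<le> s" "a \<le> c" "a < s \<or> (\<forall>y\<in>I. s \<le> y)"
      using c s by (metis linorder_not_le nle_le order_less_imp_le order_trans)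
    obtain b where b: "b \<in> I" "s \<le> b" "c \<le> b" "s < b \<or> (\<forall>y\<in>I. y \<le> s)"
      using c s by (metis linorder_not_le nle_le order_less_imp_le order_trans)
    have sub: "{a..b} \<subseteq> I"
      using mem_is_interval_1_I[OF I a(1) b(1)] by auto
    have D: "((\<lambda>u. LBINT y=c..u. f y) has_vector_derivative f s) (at s within {a..b})"
      using a b continuous_on_subset[OF f sub] by (intro interval_integral_FTC2) auto
    \<comment> \<open>An open neighbourhood of \<open>s\<close> in which \<open>I\<close> and
      \<open>{a..b}\<close> coincide, so the two derivatives at \<open>s\<close> agree, also at an
      endpoint.\<close>
    define U where "U = {y. (a < s \<longrightarrow> a < y) \<and> (s < b \<longrightarrow> y < b)}"
    have "U = (if a < s then {a<..} else UNIV) \<inter> (if s < b then {..<b} else UNIV)"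
      by (auto simp: U_def)
    then have "open U" by auto
    moreover have "s \<in> U" by (auto simp: U_def)
    moreover have "y \<in> {a..b}" if "y \<in> I" "y \<in> U" for y
      using that a b by (auto simp: U_def)
    then have "I \<inter> U - {s} = {a..b} \<inter> U - {s}"
      using sub by blast
    ultimately have "at s within I = at s within {a..b}"
      by (intro at_within_nhd)
    with D show ?thesis by simp
  qed
  then show ?thesis by blast
qed simp

section \<open>Frenet equations and regularity\<close>

lemma continuous_on_if_has_vector_derivative:
  assumes "\<And>s. s \<in> I \<Longrightarrow> (f has_vector_derivative f' s) (at s within I)"
  shows "continuous_on I f"
  using assms by (meson continuous_on_eq_continuous_within has_vector_derivative_continuous)

lemma C1_onI:
  assumes "\<And>s. s \<in> I \<Longrightarrow> (f has_vector_derivative f' s) (at s within I)" and "continuous_on I f'"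
  shows "C1_on I f"
  using assms unfolding C1_on_def by blast

text \<open>Regularity comes for free: the Frenet equations make the frame differentiable, hence
  continuous, so their right-hand sides are continuous and the frame is \<open>C1_on\<close>. Unit
  speed follows from orthonormality.\<close>

lemma frenet_apparatusI:
  assumes "tangent_on I x T"
    and frame: "\<And>s. s \<in> I \<Longrightarrow> orthonormal_positive (T s) (N s) (B s)"
    and \<kappa>: "continuous_on I \<kappa>" and \<tau>: "continuous_on I \<tau>"
    and T: "\<And>s. s \<in> I \<Longrightarrow> (T has_vector_derivative \<kappa> s *\<^sub>R N s) (at s within I)"
    and N: "\<And>s. s \<in> I \<Longrightarrow>
      (N has_vector_derivative - \<kappa> s *\<^sub>R T s + \<tau> s *\<^sub>R B s) (at s within I)"
    and B: "\<And>s. s \<in> I \<Longrightarrow> (B has_vector_derivative - \<tau> s *\<^sub>R N s) (at s within I)"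
  shows "frenet_apparatus I x T N B \<kappa> \<tau>"
proof -
  note cont = T[THEN continuous_on_if_has_vector_derivative]
    N[THEN continuous_on_if_has_vector_derivative] B[THEN continuous_on_if_has_vector_derivative]
  have "C1_on I T"
    by (rule C1_onI[OF T], assumption) (intro continuous_intros cont \<kappa> \<tau>)
  moreover have "C1_on I N"
    by (rule C1_onI[OF N], assumption) (intro continuous_intros cont \<kappa> \<tau>)
  moreover have "C1_on I B"
    by (rule C1_onI[OF B], assumption) (intro continuous_intros cont \<kappa> \<tau>)
  ultimately show ?thesis
    using assms unfolding frenet_apparatus_def unit_speed_curve_def
    by (auto simp: orthonormal_positive_def)
qed

lemma frenet_apparatusD:
  assumes "frenet_apparatus I x T N B \<kappa> \<tau>"
  shows "unit_speed_curve I x" "tangent_on I x T" "continuous_on I \<kappa>" "continuous_on I \<tau>"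
    and "\<And>s. s \<in> I \<Longrightarrow> orthonormal_positive (T s) (N s) (B s)"
    and "\<And>s. s \<in> I \<Longrightarrow> (T has_vector_derivative \<kappa> s *\<^sub>R N s) (at s within I)"
    and "\<And>s. s \<in> I \<Longrightarrow>
      (N has_vector_derivative - \<kappa> s *\<^sub>R T s + \<tau> s *\<^sub>R B s) (at s within I)"
    and "\<And>s. s \<in> I \<Longrightarrow> (B has_vector_derivative - \<tau> s *\<^sub>R N s) (at s within I)"
  using assms unfolding frenet_apparatus_def by blast+

section \<open>Rotated frames are successor systems\<close>

text \<open>Since \<phi>' = \<tau>, the terms from differentiating the angle cancel the \<tau>-terms
  of \<open>N'\<close> and \<open>B'\<close>, and only multiples of \<open>T\<close> remain in the
  derivatives of \<open>Ts\<close> and \<open>Bs\<close>. The fields are prescribed on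
  \<open>I\<close> only, so their values elsewhere stay arbitrary.\<close>

lemma rotated_frenet_apparatus:
  assumes I: "is_interval I" and app: "frenet_apparatus I x T N B \<kappa> \<tau>"
    and \<Phi>: "antiderivative_on I \<tau> \<Phi>"
    and Ts: "\<And>s. s \<in> I \<Longrightarrow> Ts s = - cos (\<phi>0 + \<Phi> s) *\<^sub>R N s + sin (\<phi>0 + \<Phi> s) *\<^sub>R B s"
    and Ns: "\<And>s. s \<in> I \<Longrightarrow> Ns s = T s"
    and Bs: "\<And>s. s \<in> I \<Longrightarrow> Bs s = sin (\<phi>0 + \<Phi> s) *\<^sub>R N s + cos (\<phi>0 + \<Phi> s) *\<^sub>R B s"
    and \<kappa>s: "\<And>s. s \<in> I \<Longrightarrow> \<kappa>s s = \<kappa> s * cos (\<phi>0 + \<Phi> s)"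
    and \<tau>s: "\<And>s. s \<in> I \<Longrightarrow> \<tau>s s = \<kappa> s * sin (\<phi>0 + \<Phi> s)"
  shows "\<exists>xs. frenet_apparatus I xs Ts Ns Bs \<kappa>s \<tau>s"
proof -
  define \<phi> where "\<phi> s = \<phi>0 + \<Phi> s" for s
  have \<phi>': "(\<phi> has_real_derivative \<tau> s) (at s within I)" if "s \<in> I" for s
    using \<Phi> that DERIV_add[OF DERIV_const[of \<phi>0], of \<Phi> "\<tau> s" s I]
    by (simp add: \<phi>_def[abs_def] antiderivative_on_def)
  have \<phi>_cont: "continuous_on I \<phi>"
    using \<phi>' DERIV_continuous_on by blast
  note \<phi>_cos' = DERIV_cos[THEN DERIV_chain2, OF \<phi>'] and \<phi>_sin' = DERIV_sin[THEN DERIV_chain2, OF \<phi>']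
  note frame' = frenet_apparatusD(7,8)[OF app]
  have Ts': "(Ts has_vector_derivative \<kappa>s s *\<^sub>R Ns s) (at s within I)" if s: "s \<in> I" for s
  proof (rule has_vector_derivative_transform[OF s Ts[folded \<phi>_def]])
    show "((\<lambda>s. - cos (\<phi> s) *\<^sub>R N s + sin (\<phi> s) *\<^sub>R B s) has_vector_derivative \<kappa>s s *\<^sub>R Ns s)
      (at s within I)"
      using has_vector_derivative_add[OF
          has_vector_derivative_scaleR[OF DERIV_minus[OF \<phi>_cos'[OF s]] frame'(1)[OF s]]
          has_vector_derivative_scaleR[OF \<phi>_sin'[OF s] frame'(2)[OF s]]]
      by (simp add: \<kappa>s[OF s] Ns[OF s] flip: \<phi>_def) (simp add: algebra_simps)
  qed
  have Bs': "(Bs has_vector_derivative - \<tau>s s *\<^sub>R Ns s) (at s within I)" if s: "s \<in> I" for s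
  proof (rule has_vector_derivative_transform[OF s Bs[folded \<phi>_def]])
    show "((\<lambda>s. sin (\<phi> s) *\<^sub>R N s + cos (\<phi> s) *\<^sub>R B s) has_vector_derivative - \<tau>s s *\<^sub>R Ns s)
      (at s within I)"
      using has_vector_derivative_add[OF
          has_vector_derivative_scaleR[OF \<phi>_sin'[OF s] frame'(1)[OF s]]
          has_vector_derivative_scaleR[OF \<phi>_cos'[OF s] frame'(2)[OF s]]]
      by (simp add: \<tau>s[OF s] Ns[OF s] flip: \<phi>_def) (simp add: algebra_simps)
  qed
  have Ns': "(Ns has_vector_derivative - \<kappa>s s *\<^sub>R Ts s + \<tau>s s *\<^sub>R Bs s) (at s within I)"
    if s: "s \<in> I" for s
  proof -
    \<comment> \<open>Inserting cos^2 + sin^2 = 1 splits \<open>T'\<close> into its components along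
      \<open>Ts\<close> and \<open>Bs\<close>.\<close>
    have "\<kappa> s *\<^sub>R N s = (\<kappa> s * (cos (\<phi> s) * cos (\<phi> s) + sin (\<phi> s) * sin (\<phi> s))) *\<^sub>R N s"
      by simp
    also have "\<dots> = - \<kappa>s s *\<^sub>R Ts s + \<tau>s s *\<^sub>R Bs s"
      unfolding Ts[OF s] Bs[OF s] \<kappa>s[OF s] \<tau>s[OF s] \<phi>_def
      by (simp only: algebra_simps scaleR_scaleR) (simp add: algebra_simps)
    finally show ?thesis
      using has_vector_derivative_transform[OF s Ns frenet_apparatusD(6)[OF app s]] by simp
  qed
  have "continuous_on I \<kappa>s" "continuous_on I \<tau>s"
    using continuous_on_mult[OF frenet_apparatusD(3)[OF app] continuous_on_cos[OF \<phi>_cont]]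
      continuous_on_mult[OF frenet_apparatusD(3)[OF app] continuous_on_sin[OF \<phi>_cont]]
    by (simp_all add: \<kappa>s \<tau>s \<phi>_def cong: continuous_on_cong)
  \<comment> \<open>The successor curve is obtained by integrating its tangent, which is continuous
    because it is differentiable.\<close>
  moreover obtain xs where "tangent_on I xs Ts"
    using interval_antiderivative[OF I continuous_on_if_has_vector_derivative[OF Ts']]
    unfolding tangent_on_def by blast
  moreover have "orthonormal_positive (Ts s) (Ns s) (Bs s)" if "s \<in> I" for s
    using orthonormal_positive_rotate[OF frenet_apparatusD(5)[OF app that]]
    by (simp add: Ts Ns Bs that)
  ultimately show ?thesis
    using frenet_apparatusI[of I xs Ts Ns Bs \<kappa>s \<tau>s] Ts' Ns' Bs' by blast
qed

section \<open>Every successor system is a rotated frame\<close>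

text \<open>A connected set with more than one point has no isolated points. This makes derivatives
  within \<open>I\<close> unique, so that two expressions for \<open>T'\<close> can be
  equated.\<close>

lemma at_within_interval_neq_bot:
  fixes I :: "real set"
  assumes "is_interval I" "interior I \<noteq> {}" "s \<in> I"
  shows "at s within I \<noteq> bot"
proof -
  have "s islimpt I"
    using assms by (intro connected_imp_perfect is_interval_connected) auto
  then show ?thesis
    by (simp add: trivial_limit_within)
qed

lemma has_vector_derivative_inner:
  assumes "(f has_vector_derivative f') (at s within S)"
    and "(g has_vector_derivative g') (at s within S)"
  shows "((\<lambda>s. f s \<bullet> g s) has_real_derivative f s \<bullet> g' + f' \<bullet> g s) (at s within S)"
  using bounded_bilinear.has_vector_derivative[OF bounded_bilinear_inner assms]
  by (simp add: has_real_derivative_iff_has_vector_derivative)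

lemma successor_system_is_rotated:
  assumes I: "is_interval I" "interior I \<noteq> {}" and app: "frenet_apparatus I x T N B \<kappa> \<tau>"
    and \<Phi>: "antiderivative_on I \<tau> \<Phi>" and succ: "successor_system I T Ts Ns Bs \<kappa>s \<tau>s"
  obtains \<phi>0 where "\<And>s. s \<in> I \<Longrightarrow> Ts s = - cos (\<phi>0 + \<Phi> s) *\<^sub>R N s + sin (\<phi>0 + \<Phi> s) *\<^sub>R B s"
    and "\<And>s. s \<in> I \<Longrightarrow> Ns s = T s"
    and "\<And>s. s \<in> I \<Longrightarrow> Bs s = sin (\<phi>0 + \<Phi> s) *\<^sub>R N s + cos (\<phi>0 + \<Phi> s) *\<^sub>R B s"
    and "\<And>s. s \<in> I \<Longrightarrow> \<kappa>s s = \<kappa> s * cos (\<phi>0 + \<Phi> s)"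
    and "\<And>s. s \<in> I \<Longrightarrow> \<tau>s s = \<kappa> s * sin (\<phi>0 + \<Phi> s)"
proof -
  obtain xs where app_s: "frenet_apparatus I xs Ts Ns Bs \<kappa>s \<tau>s"
    and Ns: "\<And>s. s \<in> I \<Longrightarrow> Ns s = T s"
    using succ unfolding successor_system_def by blast
  note frame = frenet_apparatusD(5)[OF app]
  have frame_s: "orthonormal_positive (Ts s) (T s) (Bs s)" if "s \<in> I" for s
    using frenet_apparatusD(5)[OF app_s that] Ns that by simp
  define p where "p s = Ts s \<bullet> N s" for s
  define q where "q s = Ts s \<bullet> B s" for s
  \<comment> \<open>\<open>Ts'\<close> is a multiple of \<open>T\<close>, hence orthogonal to
    \<open>N\<close> and \<open>B\<close>; so only \<open>N'\<close> contributes here and only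
    \<open>B'\<close> to \<open>q'\<close>, and their \<open>T\<close>-components drop out because
    \<open>Ts\<close> is orthogonal to \<open>T\<close>.\<close>
  have p': "(p has_real_derivative \<tau> s * q s) (at s within I)" if s: "s \<in> I" for s
    unfolding p_def
    using has_vector_derivative_inner[OF frenet_apparatusD(6)[OF app_s s] frenet_apparatusD(7)[OF app s]]
    using orthonormal_positiveD[OF frame[OF s]] orthonormal_positiveD[OF frame_s[OF s]]
    by (simp add: Ns s inner_simps q_def)
  have q': "(q has_real_derivative - \<tau> s * p s) (at s within I)" if s: "s \<in> I" for s
    unfolding q_def
    using has_vector_derivative_inner[OF frenet_apparatusD(6)[OF app_s s] frenet_apparatusD(8)[OF app s]]
    using orthonormal_positiveD[OF frame[OF s]] orthonormal_positiveD[OF frame_s[OF s]]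
    by (simp add: Ns s inner_simps p_def)
  have \<Phi>': "(\<Phi> has_real_derivative \<tau> s) (at s within I)" if "s \<in> I" for s
    using \<Phi> that by (simp add: antiderivative_on_def)
  have Ts_pq: "Ts s = p s *\<^sub>R N s + q s *\<^sub>R B s" if s: "s \<in> I" for s
    unfolding p_def q_def
    using orthonormal_positive_expand[OF frame[OF s]] orthonormal_positiveD[OF frame_s[OF s]]
    by blast
  \<comment> \<open>This and the next quantity undo the motion of \<open>(p, q)\<close> through the
    angle \<Phi>. The signs are chosen so that \<open>c\<close> and \<open>d\<close> become the
    cosine and sine of \<phi>0.\<close>
  have "\<exists>c. \<forall>s\<in>I. - cos (\<Phi> s) * p s + sin (\<Phi> s) * q s = c"
    using is_interval_convex[OF I(1)]
    by (rule has_field_derivative_zero_constant)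
       (auto intro!: derivative_eq_intros p' q' \<Phi>' simp: algebra_simps)
  then obtain c where c: "\<And>s. s \<in> I \<Longrightarrow> - cos (\<Phi> s) * p s + sin (\<Phi> s) * q s = c"
    by blast
  have "\<exists>d. \<forall>s\<in>I. sin (\<Phi> s) * p s + cos (\<Phi> s) * q s = d"
    using is_interval_convex[OF I(1)]
    by (rule has_field_derivative_zero_constant)
       (auto intro!: derivative_eq_intros p' q' \<Phi>' simp: algebra_simps)
  then obtain d where d: "\<And>s. s \<in> I \<Longrightarrow> sin (\<Phi> s) * p s + cos (\<Phi> s) * q s = d"
    by blast
  obtain r where r: "r \<in> I"
    using I(2) interior_subset by blast
  \<comment> \<open>One point \<open>r\<close> suffices, as \<open>c\<close> and \<open>d\<close>
    are constant: \<open>(c, d)\<close> has the same length as \<open>(p r, q r)\<close>, namely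
    that of the unit vector \<open>Ts r\<close>.\<close>
  have "(p r)\<^sup>2 + (q r)\<^sup>2 = Ts r \<bullet> Ts r"
    using orthonormal_positiveD[OF frame[OF r]]
    by (simp add: Ts_pq r inner_simps power2_eq_square)
  moreover have "c\<^sup>2 + d\<^sup>2 = ((sin (\<Phi> r))\<^sup>2 + (cos (\<Phi> r))\<^sup>2) * ((p r)\<^sup>2 + (q r)\<^sup>2)"
    unfolding c[OF r, symmetric] d[OF r, symmetric] by algebra
  ultimately have "c\<^sup>2 + d\<^sup>2 = 1"
    using orthonormal_positiveD[OF frame_s[OF r]] by simp
  then obtain \<phi>0 where \<phi>0: "c = cos \<phi>0" "d = sin \<phi>0"
    using sincos_total_2pi by metis
  have pq: "p s = - cos (\<phi>0 + \<Phi> s)" "q s = sin (\<phi>0 + \<Phi> s)" if s: "s \<in> I" for s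
  proof -
    \<comment> \<open>Solves the two linear relations for \<open>p\<close> and \<open>q\<close>; the
      addition formulas then merge \<phi>0 with \<Phi>.\<close>
    have "p s * ((sin (\<Phi> s))\<^sup>2 + (cos (\<Phi> s))\<^sup>2) = - cos (\<Phi> s) * c + sin (\<Phi> s) * d"
      "q s * ((sin (\<Phi> s))\<^sup>2 + (cos (\<Phi> s))\<^sup>2) = sin (\<Phi> s) * c + cos (\<Phi> s) * d"
      unfolding c[OF s, symmetric] d[OF s, symmetric] by algebra+
    then show "p s = - cos (\<phi>0 + \<Phi> s)" "q s = sin (\<phi>0 + \<Phi> s)"
      by (simp_all add: \<phi>0 cos_add sin_add algebra_simps)
  qed
  have Ts: "Ts s = - cos (\<phi>0 + \<Phi> s) *\<^sub>R N s + sin (\<phi>0 + \<Phi> s) *\<^sub>R B s" if s: "s \<in> I" for s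
    using Ts_pq[OF s] pq[OF s] by simp
  \<comment> \<open>Both frames are positive and share their first two vectors, whose cross product
    is the third.\<close>
  have Bs: "Bs s = sin (\<phi>0 + \<Phi> s) *\<^sub>R N s + cos (\<phi>0 + \<Phi> s) *\<^sub>R B s" if s: "s \<in> I" for s
    using frame_s[OF s] orthonormal_positive_rotate[OF frame[OF s], of "\<phi>0 + \<Phi> s"]
    by (simp add: Ts s orthonormal_positive_iff_cross)
  \<comment> \<open>\<open>T\<close> is differentiated once as tangent of the given frame and once
    as principal normal of the successor. Inner products with \<open>Ts\<close> and
    \<open>Bs\<close> then give \<open>\<kappa>s\<close> and \<open>\<tau>s\<close> without dividing
    by \<kappa>, which may vanish.\<close>
  have T': "\<kappa> s *\<^sub>R N s = - \<kappa>s s *\<^sub>R Ts s + \<tau>s s *\<^sub>R Bs s" if s: "s \<in> I" for s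
    using at_within_interval_neq_bot[OF I s] frenet_apparatusD(6)[OF app s]
      has_vector_derivative_transform[OF s Ns[symmetric] frenet_apparatusD(7)[OF app_s s]]
    by (rule vector_derivative_unique_within)
  have \<kappa>s: "\<kappa>s s = \<kappa> s * cos (\<phi>0 + \<Phi> s)" if s: "s \<in> I" for s
  proof -
    have "- \<kappa>s s = (\<kappa> s *\<^sub>R N s) \<bullet> Ts s"
      unfolding T'[OF s] using orthonormal_positiveD[OF frame_s[OF s]] by (simp add: inner_simps)
    also have "\<dots> = - (\<kappa> s * cos (\<phi>0 + \<Phi> s))"
      unfolding Ts[OF s] using orthonormal_positiveD[OF frame[OF s]] by (simp add: inner_simps)
    finally show ?thesis by simp
  qed
  have \<tau>s: "\<tau>s s = \<kappa> s * sin (\<phi>0 + \<Phi> s)" if s: "s \<in> I" for s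
  proof -
    have "\<tau>s s = (\<kappa> s *\<^sub>R N s) \<bullet> Bs s"
      unfolding T'[OF s] using orthonormal_positiveD[OF frame_s[OF s]] by (simp add: inner_simps)
    also have "\<dots> = \<kappa> s * sin (\<phi>0 + \<Phi> s)"
      unfolding Bs[OF s] using orthonormal_positiveD[OF frame[OF s]] by (simp add: inner_simps)
    finally show ?thesis .
  qed
  show thesis
    using Ts Ns Bs \<kappa>s \<tau>s by (rule that)
qed

section \<open>The Darboux vector and the whole family\<close>

text \<open>The \<open>N\<close>-components of \<open>\<tau>s Ts\<close> and
  \<open>\<kappa>s Bs\<close> are opposite, and the \<open>B\<close>-components add up to \<kappa>
  (sin^2 + cos^2).\<close>

lemma darboux_rotated:
  assumes "Ts s = - cos a *\<^sub>R N s + sin a *\<^sub>R B s" "Bs s = sin a *\<^sub>R N s + cos a *\<^sub>R B s"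
    and "\<kappa>s s = \<kappa> s * cos a" "\<tau>s s = \<kappa> s * sin a"
  shows "darboux Ts Bs \<kappa>s \<tau>s s = \<kappa> s *\<^sub>R B s"
proof -
  have "darboux Ts Bs \<kappa>s \<tau>s s = (\<kappa> s * (cos a * cos a + sin a * sin a)) *\<^sub>R B s"
    unfolding darboux_def assms by (simp only: algebra_simps scaleR_scaleR) simp
  then show ?thesis by simp
qed

theorem theorem3p1:
  fixes I :: "real set" and x T N B :: "real \<Rightarrow> real^3" and \<kappa> \<tau> :: "real \<Rightarrow> real"
  assumes "is_interval I" and "interior I \<noteq> {}"
    and "frenet_apparatus I x T N B \<kappa> \<tau>"
  shows "(\<exists>\<Phi>. antiderivative_on I \<tau> \<Phi>) \<and>
    (\<forall>\<Phi>. antiderivative_on I \<tau> \<Phi> \<longrightarrow>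
      (\<forall>Ts Ns Bs \<kappa>s \<tau>s.
        successor_system I T Ts Ns Bs \<kappa>s \<tau>s \<longleftrightarrow>
        (\<exists>\<phi>0::real. \<forall>s\<in>I. let \<phi> = \<phi>0 + \<Phi> s in
           Ts s = - cos \<phi> *\<^sub>R N s + sin \<phi> *\<^sub>R B s \<and>
           Ns s = T s \<and>
           Bs s = sin \<phi> *\<^sub>R N s + cos \<phi> *\<^sub>R B s \<and>
           \<kappa>s s = \<kappa> s * cos \<phi> \<and>
           \<tau>s s = \<kappa> s * sin \<phi>)) \<and>
      (\<forall>\<phi>0::real. \<exists>xs. successor_curve I x xs \<and>
         frenet_apparatus I xs
           (\<lambda>s. - cos (\<phi>0 + \<Phi> s) *\<^sub>R N s + sin (\<phi>0 + \<Phi> s) *\<^sub>R B s)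
           T
           (\<lambda>s. sin (\<phi>0 + \<Phi> s) *\<^sub>R N s + cos (\<phi>0 + \<Phi> s) *\<^sub>R B s)
           (\<lambda>s. \<kappa> s * cos (\<phi>0 + \<Phi> s))
           (\<lambda>s. \<kappa> s * sin (\<phi>0 + \<Phi> s)))) \<and>
    (\<forall>Ts Ns Bs \<kappa>s \<tau>s. successor_system I T Ts Ns Bs \<kappa>s \<tau>s \<longrightarrow>
      (\<forall>s\<in>I. darboux Ts Bs \<kappa>s \<tau>s s = \<kappa> s *\<^sub>R B s))"
proof -
  note app = assms(3)
  note rotated = rotated_frenet_apparatus[OF assms(1) app]
  have ex: "\<exists>\<Phi>. antiderivative_on I \<tau> \<Phi>"
    using interval_antiderivative[OF assms(1) frenet_apparatusD(4)[OF app]]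
    by (simp add: antiderivative_on_def has_real_derivative_iff_has_vector_derivative)
  have systems: "successor_system I T Ts Ns Bs \<kappa>s \<tau>s \<longleftrightarrow>
        (\<exists>\<phi>0::real. \<forall>s\<in>I. let \<phi> = \<phi>0 + \<Phi> s in
           Ts s = - cos \<phi> *\<^sub>R N s + sin \<phi> *\<^sub>R B s \<and>
           Ns s = T s \<and>
           Bs s = sin \<phi> *\<^sub>R N s + cos \<phi> *\<^sub>R B s \<and>
           \<kappa>s s = \<kappa> s * cos \<phi> \<and>
           \<tau>s s = \<kappa> s * sin \<phi>)" (is "?L \<longleftrightarrow> ?R")
    if \<Phi>: "antiderivative_on I \<tau> \<Phi>" for \<Phi> Ts Ns Bs \<kappa>s \<tau>s
  proof
    assume ?L
    from successor_system_is_rotated[OF assms \<Phi> this] show ?R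
      unfolding Let_def by metis
  next
    assume ?R
    then obtain \<phi>0 where *: "\<forall>s\<in>I. let \<phi> = \<phi>0 + \<Phi> s in
           Ts s = - cos \<phi> *\<^sub>R N s + sin \<phi> *\<^sub>R B s \<and>
           Ns s = T s \<and>
           Bs s = sin \<phi> *\<^sub>R N s + cos \<phi> *\<^sub>R B s \<and>
           \<kappa>s s = \<kappa> s * cos \<phi> \<and>
           \<tau>s s = \<kappa> s * sin \<phi>" by blast
    then have "\<exists>xs. frenet_apparatus I xs Ts Ns Bs \<kappa>s \<tau>s"
      unfolding Let_def by (intro rotated[OF \<Phi>, of Ts \<phi>0 Ns Bs]) blast+
    with * show ?L
      unfolding successor_system_def Let_def by blast
  qed
  have curves: "\<exists>xs. successor_curve I x xs \<and>
         frenet_apparatus I xs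
           (\<lambda>s. - cos (\<phi>0 + \<Phi> s) *\<^sub>R N s + sin (\<phi>0 + \<Phi> s) *\<^sub>R B s)
           T
           (\<lambda>s. sin (\<phi>0 + \<Phi> s) *\<^sub>R N s + cos (\<phi>0 + \<Phi> s) *\<^sub>R B s)
           (\<lambda>s. \<kappa> s * cos (\<phi>0 + \<Phi> s))
           (\<lambda>s. \<kappa> s * sin (\<phi>0 + \<Phi> s))" (is "\<exists>xs. _ \<and> ?app xs")
    if \<Phi>: "antiderivative_on I \<tau> \<Phi>" for \<Phi> \<phi>0
  proof -
    obtain xs where xs: "?app xs"
      using rotated[OF \<Phi> refl refl refl refl refl] by blast
    \<comment> \<open>The common witness is \<open>T\<close>: tangent of \<open>x\<close> and, by
      the apparatus just obtained, principal normal of \<open>xs\<close>.\<close>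
    then have "successor_curve I x xs"
      using frenet_apparatusD(1)[OF xs] frenet_apparatusD(1,2)[OF app]
      unfolding successor_curve_def principal_normal_def by blast
    with xs show ?thesis by blast
  qed
  have "darboux Ts Bs \<kappa>s \<tau>s s = \<kappa> s *\<^sub>R B s"
    if succ: "successor_system I T Ts Ns Bs \<kappa>s \<tau>s" and s: "s \<in> I" for Ts Ns Bs \<kappa>s \<tau>s s
  proof -
    \<comment> \<open>The claim does not mention the angle, so any antiderivative may be used to
      represent the successor system.\<close>
    obtain \<Phi> where \<Phi>: "antiderivative_on I \<tau> \<Phi>"
      using ex by blast
    from successor_system_is_rotated[OF assms \<Phi> succ] s show ?thesis
      by (metis darboux_rotated)
  qed
  with ex systems curves show ?thesis by blast
qed

end
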